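(* Let $X\subset\mathbb{R}\mathbb{P}^n$ be a totally real projective variety. (1) If $Y\subset X$ is a totally real projective subvariety, then $ZI(Y)\cap X=Y$. (2) If $Y$ is an irreducible $p$-dimensional totally real projective subvariety of $X$, then $ZI(Y)$ is an irreducible complex $p$-dimensional projective subvariety of $ZI(X)$. (3) If $V$ is a complex $p$-dimensional irreducible projective subvariety of $ZI(X)$ and $\dim_{\mathbb{R}}(V\cap X)=p$, then $V\cap X$ is an irreducible totally real projective subvariety of $X$ and $ZI(V\cap X)=V$.
   Context: A totally real projective variety is the zero locus in $\mathbb{R}\mathbb{P}^n$ of some real homogeneous polynomials; $\mathbb{R}\mathbb{P}^n$ is regarded as a subset of the complex projective space $\mathbb{P}^n$. For $X\subset\mathbb{R}\mathbb{P}^n$, the real cone is $RC(X)=\pi^{-1}(X)\cup\{0\}$ with $\pi:\mathbb{R}^{n+1}\setminus\{0\}\to\mathbb{R}\mathbb{P}^n$ the quotient map. $I^{\mathbb{C}}(X)\subset\mathbb{C}[z_0,\dots,z_n]$ is the ideal generated by the homogeneous polynomials vanishing on $RC(X)\subset\mathbb{C}^{n+1}$, and $ZI(X)=ZI^{\mathbb{C}}(X)\subset\mathbb{P}^n$ is the complex projective variety it defines (the smallest complex projective variety containing $X$). The dimension of a totally real algebraic variety $V\subset\mathbb{R}^m$ is the maximal length of chains of prime ideals in $\mathbb{R}[x_1,\dots,x_m]/I(V)$, and the dimension of a totally real projective variety is the dimension of its real cone minus 1. *)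

theory Defs
  imports
    "HOL-Analysis.Analysis"
    "HOL-Algebra.QuotRing"
    "HOL-Library.Poly_Mapping"
begin

section \<open>Projective space over a field\<close>

text \<open>
  Homogeneous coordinates are indexed by a finite type \<open>'n\<close>, so that \<open>('k, 'n) proj\<close> is
  projective space of dimension \<open>CARD('n) - 1\<close> over \<open>'k\<close>.
\<close>

definition projrel :: "('k::field) ^ 'n \<Rightarrow> 'k ^ 'n \<Rightarrow> bool"
  where "projrel v w \<longleftrightarrow> v \<noteq> 0 \<and> w \<noteq> 0 \<and> (\<exists>c. c \<noteq> 0 \<and> w = c *s v)"

lemma part_equivp_projrel: "part_equivp (projrel :: ('k::field) ^ 'n \<Rightarrow> _)"
proof (rule part_equivpI)
  have "projrel (1 :: 'k ^ 'n) 1"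
    by (auto simp: projrel_def intro!: exI[of _ "1::'k"])
  then show "\<exists>v :: 'k ^ 'n. projrel v v" by blast
  show "symp (projrel :: 'k ^ 'n \<Rightarrow> _)"
  proof (rule sympI)
    fix v w :: "'k ^ 'n"
    assume "projrel v w"
    then obtain c where c: "v \<noteq> 0" "w \<noteq> 0" "c \<noteq> 0" "w = c *s v"
      by (auto simp: projrel_def)
    then have "v = inverse c *s w" by (simp add: vector_smult_assoc)
    with c show "projrel w v"
      unfolding projrel_def by (metis inverse_nonzero_iff_nonzero)
  qed
  show "transp (projrel :: 'k ^ 'n \<Rightarrow> _)"
    by (rule transpI) (auto simp: projrel_def vector_smult_assoc intro: no_zero_divisors)
qed

quotient_type (overloaded) ('k, 'n) proj = "('k::field) ^ ('n::finite)" / partial: projrel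
  morphisms rep_proj proj_point
  by (rule part_equivp_projrel)

text \<open>
  \<open>proj_point v\<close> is the quotient map; it is meaningful only for \<open>v \<noteq> 0\<close>, and every use
  below is guarded accordingly.
\<close>

lemma proj_point_eq_iff:
  assumes "v \<noteq> 0" "w \<noteq> 0"
  shows "proj_point v = proj_point w \<longleftrightarrow> (\<exists>c. c \<noteq> 0 \<and> w = c *s v)"
proof -
  have refl: "projrel u u" if "u \<noteq> 0" for u :: "'a ^ 'b"
    using that by (auto simp: projrel_def intro!: exI[of _ "1::'a"])
  show ?thesis
    using Quotient3_rel[OF Quotient3_proj, of v w] refl[OF assms(1)] refl[OF assms(2)] assms
    by (auto simp: projrel_def)
qed

definition affine_cone :: "('k::field, 'n::finite) proj set \<Rightarrow> ('k ^ 'n) set"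
  where "affine_cone X = {v. v \<noteq> 0 \<and> proj_point v \<in> X} \<union> {0}"


section \<open>Polynomials and projective varieties\<close>

text \<open>
  A polynomial in the variables \<open>'n\<close> is a finitely supported map from exponent vectors to
  coefficients; multiplication is the convolution product of \<open>poly_mapping\<close>.
\<close>

type_synonym ('k, 'n) mpoly = "('n \<Rightarrow>\<^sub>0 nat) \<Rightarrow>\<^sub>0 'k"

abbreviation mpoly_ring :: "('k::comm_ring_1, 'n) mpoly ring"
  where "mpoly_ring \<equiv> \<lparr>carrier = UNIV, mult = (*), one = 1, zero = 0, add = (+)\<rparr>"

definition eval_mpoly :: "('k::comm_semiring_1, 'n::finite) mpoly \<Rightarrow> 'k ^ 'n \<Rightarrow> 'k"
  where "eval_mpoly f v =
    (\<Sum>m\<in>Poly_Mapping.keys f. Poly_Mapping.lookup f m * (\<Prod>i\<in>UNIV. (v $ i) ^ Poly_Mapping.lookup m i))"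

definition homogeneous_mpoly :: "('k::zero, 'n::finite) mpoly \<Rightarrow> bool"
  where "homogeneous_mpoly f \<longleftrightarrow>
    (\<exists>d. \<forall>m\<in>Poly_Mapping.keys f. (\<Sum>i\<in>UNIV. Poly_Mapping.lookup m i) = d)"

text \<open>
  Only used for sets of homogeneous polynomials and for homogeneous ideals, where vanishing at
  \<open>v\<close> does not depend on the choice of \<open>v\<close> representing the point.
\<close>

definition zero_locus :: "('k::field, 'n::finite) mpoly set \<Rightarrow> ('k, 'n) proj set"
  where "zero_locus S = {proj_point v |v. v \<noteq> 0 \<and> (\<forall>f\<in>S. eval_mpoly f v = 0)}"

text \<open>
  For \<open>'k = real\<close> these are the totally real projective varieties, for \<open>'k = complex\<close> the
  complex projective varieties. They need not be irreducible and may be empty.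
\<close>

definition projective_variety :: "('k::field, 'n::finite) proj set \<Rightarrow> bool"
  where "projective_variety X \<longleftrightarrow>
    (\<exists>S. (\<forall>f\<in>S. homogeneous_mpoly f) \<and> X = zero_locus S)"

definition irreducible_variety :: "('k::field, 'n::finite) proj set \<Rightarrow> bool"
  where "irreducible_variety X \<longleftrightarrow> projective_variety X \<and> X \<noteq> {} \<and>
    (\<forall>A B. projective_variety A \<longrightarrow> projective_variety B \<longrightarrow> X = A \<union> B \<longrightarrow> X = A \<or> X = B)"


section \<open>Dimension\<close>

text \<open>
  The length of \<open>P 0 \<subset> \<dots> \<subset> P n\<close> is \<open>n\<close>. Extended reals are used because the supremum may
  a priori be infinite and because the empty projective variety, whose cone is \<open>{0}\<close>, has
  dimension \<open>-1\<close>.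
\<close>

definition krull_dim :: "('a, 'b) ring_scheme \<Rightarrow> ereal"
  where "krull_dim R = (SUP n \<in> {n. \<exists>P :: nat \<Rightarrow> 'a set.
    (\<forall>i\<le>n. primeideal (P i) R) \<and> (\<forall>i<n. P i \<subset> P (Suc i))}. ereal (real n))"

definition vanishing_ideal :: "(('k::comm_ring_1) ^ ('n::finite)) set \<Rightarrow> ('k, 'n) mpoly set"
  where "vanishing_ideal V = {f. \<forall>v\<in>V. eval_mpoly f v = 0}"

definition affine_dim :: "(('k::comm_ring_1) ^ ('n::finite)) set \<Rightarrow> ereal"
  where "affine_dim V = krull_dim (mpoly_ring Quot (vanishing_ideal V))"

definition proj_dim :: "('k::field, 'n::finite) proj set \<Rightarrow> ereal"
  where "proj_dim X = affine_dim (affine_cone X) - 1"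


section \<open>Real and complex projective space\<close>

definition complex_vec :: "real ^ 'n \<Rightarrow> complex ^ ('n::finite)"
  where "complex_vec v = (\<chi> i. complex_of_real (v $ i))"

lemma complex_vec_eq_0_iff [simp]: "complex_vec v = 0 \<longleftrightarrow> v = 0"
  by (simp add: complex_vec_def vec_eq_iff)

lemma complex_vec_scale: "complex_vec (c *s v) = complex_of_real c *s complex_vec v"
  by (simp add: complex_vec_def vec_eq_iff)

lift_definition complex_point :: "(real, 'n::finite) proj \<Rightarrow> (complex, 'n) proj" is complex_vec
  by (auto simp: projrel_def complex_vec_scale)

lemma complex_point_proj_point:
  assumes "v \<noteq> 0"
  shows "complex_point (proj_point v) = proj_point (complex_vec v)"
proof -
  have "projrel v v"
    using assms by (auto simp: projrel_def intro!: exI[of _ "1::real"])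
  then show ?thesis by (rule complex_point.abs_eq)
qed

lemma inj_complex_point: "inj (complex_point :: (real, 'n::finite) proj \<Rightarrow> _)"
proof (rule injI)
  fix P Q :: "(real, 'n) proj"
  assume eq: "complex_point P = complex_point Q"
  have rep: "\<exists>v. v \<noteq> 0 \<and> R = proj_point v" for R :: "(real, 'n) proj"
    using Quotient3_rep_reflp[OF Quotient3_proj, of R] Quotient3_abs_rep[OF Quotient3_proj, of R]
    by (metis projrel_def)
  obtain v w where v: "v \<noteq> 0" "P = proj_point v" and w: "w \<noteq> 0" "Q = proj_point w"
    using rep by metis
  obtain c where c: "c \<noteq> 0" "complex_vec w = c *s complex_vec v"
    using eq v w by (auto simp: complex_point_proj_point proj_point_eq_iff)
  have wi: "complex_of_real (w $ i) = c * complex_of_real (v $ i)" for i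
    using c(2) by (simp add: complex_vec_def vec_eq_iff)
  obtain j where j: "v $ j \<noteq> 0" using v(1) by (auto simp: vec_eq_iff)
  have "c = complex_of_real (w $ j / v $ j)" using wi[of j] j by simp
  then have "c = complex_of_real (Re c)" by (metis Re_complex_of_real)
  then have "w $ i = Re c * v $ i" for i
    using wi[of i] by (metis of_real_eq_iff of_real_mult)
  then have "w = Re c *s v" by (simp add: vec_eq_iff)
  moreover from this w(1) have "Re c \<noteq> 0" by auto
  ultimately show "P = Q" using v w by (auto simp: proj_point_eq_iff)
qed

text \<open>The intersection of \<open>V \<subseteq> \<complex>\<bbbP>\<^sup>n\<close> with \<open>X \<subseteq> \<real>\<bbbP>\<^sup>n\<close>, as a subset of \<open>\<real>\<bbbP>\<^sup>n\<close>.\<close>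

definition real_inter :: "(complex, 'n::finite) proj set \<Rightarrow> (real, 'n) proj set \<Rightarrow> (real, 'n) proj set"
    (infixl \<open>\<inter>\<^sub>R\<close> 70)
  where "V \<inter>\<^sub>R X = complex_point -` V \<inter> X"

lemma complex_point_image_real_inter:
  "complex_point ` (V \<inter>\<^sub>R X) = V \<inter> complex_point ` X"
  by (auto simp: real_inter_def)

definition complex_ideal :: "(real, 'n::finite) proj set \<Rightarrow> (complex, 'n) mpoly set"
  where "complex_ideal X =
    Idl\<^bsub>mpoly_ring\<^esub> {f. homogeneous_mpoly f \<and> (\<forall>v\<in>affine_cone X. eval_mpoly f (complex_vec v) = 0)}"

definition ZI :: "(real, 'n::finite) proj set \<Rightarrow> (complex, 'n) proj set"
  where "ZI X = zero_locus (complex_ideal X)"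

end

theory Submission
  imports Defs "HOL-Computational_Algebra.Polynomial"
begin

text \<open>
  The closure \<open>ZI X\<close> is the zero locus of the complex forms vanishing on the real cone of
  \<open>X\<close>, so it is the smallest complex projective variety containing \<open>X\<close> (\<open>ZI_minimal\<close>).
  A real form vanishing on \<open>Y\<close> is also a complex form vanishing on \<open>Y\<close>, so \<open>ZI Y\<close> has no
  real points outside the real variety \<open>Y\<close> (\<open>real_points_ZI\<close>); this is the first claim.
  Conversely the real points of a complex variety form a real variety, cut out by the real and
  imaginary parts of its equations. Hence a decomposition of \<open>ZI Y\<close> into complex varieties
  restricts to a decomposition of \<open>Y\<close>, and one of \<open>Y\<close> into real varieties extends to
  \<open>ZI Y\<close>: for a real variety \<open>Y\<close>, irreducibility of \<open>Y\<close> and of \<open>ZI Y\<close> are equivalent.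

  The dimensions of \<open>Y\<close> and \<open>ZI Y\<close> agree for every \<open>Y\<close> (\<open>proj_dim_ZI\<close>). The polynomials
  vanishing on the complex cone of \<open>ZI Y\<close> are exactly those vanishing on the real cone of \<open>Y\<close>;
  those among them with real coefficients form the ideal of the real cone. So one compares
  \<open>\<complex>[z]/K\<close> with \<open>\<real>[x]/(K \<inter> \<real>[x])\<close>. This extension is integral, of a very special kind:
  \<open>f + cnj f\<close> and \<open>f * cnj f\<close> are real for every \<open>f\<close>. Incomparability and going up then have
  short direct proofs, and give equal Krull dimensions (\<open>krull_dim_contract\<close>).

  For the third claim put \<open>Y = V \<inter>\<^sub>R X\<close>. Then \<open>ZI Y \<subseteq> V\<close> by minimality, and both have
  dimension \<open>p\<close>. The ideal of the cone of the irreducible variety \<open>V\<close> is prime, so if the ideal of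
  \<open>ZI Y\<close> were strictly larger, every chain of primes above it could be prolonged downwards,
  and the finite dimension of \<open>V\<close> would exceed that of \<open>ZI Y\<close>
  (\<open>irreducible_eq_if_proj_dim_eq\<close>). Thus \<open>ZI Y = V\<close>, and \<open>Y\<close> is irreducible because its
  closure is.
\<close>

section \<open>Prime ideals of commutative rings\<close>

text \<open>
  The ring structure of a type class instance as a record. Ideals and prime ideals of this
  record are described below without carriers, which lets the type class automation apply.
\<close>

abbreviation type_ring :: "'a::comm_ring_1 ring"
  where "type_ring \<equiv> \<lparr>carrier = UNIV, mult = (*), one = 1, zero = 0, add = (+)\<rparr>"

text \<open>
  Ideals of \<open>type_ring\<close> (see \<open>ideal_type_ring_iff\<close>).
\<close>

definition is_ideal :: "'a::comm_ring_1 set \<Rightarrow> bool"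
  where "is_ideal I \<longleftrightarrow> 0 \<in> I \<and> (\<forall>a\<in>I. \<forall>b\<in>I. a + b \<in> I) \<and> (\<forall>a\<in>I. \<forall>r. r * a \<in> I)"

text \<open>
  Prime ideals of \<open>type_ring\<close> (see \<open>primeideal_type_ring_iff\<close>); they are proper.
\<close>

definition is_prime_ideal :: "'a::comm_ring_1 set \<Rightarrow> bool"
  where "is_prime_ideal P \<longleftrightarrow> is_ideal P \<and> 1 \<notin> P \<and> (\<forall>a b. a * b \<in> P \<longrightarrow> a \<in> P \<or> b \<in> P)"

lemma is_idealD:
  assumes "is_ideal I"
  shows "0 \<in> I" "a \<in> I \<Longrightarrow> b \<in> I \<Longrightarrow> a + b \<in> I" "a \<in> I \<Longrightarrow> r * a \<in> I"
    "a \<in> I \<Longrightarrow> a * r \<in> I" "a \<in> I \<Longrightarrow> - a \<in> I" "a \<in> I \<Longrightarrow> b \<in> I \<Longrightarrow> a - b \<in> I"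
proof -
  show *: "0 \<in> I" "a \<in> I \<Longrightarrow> b \<in> I \<Longrightarrow> a + b \<in> I" "a \<in> I \<Longrightarrow> r * a \<in> I" for a b r
    using assms by (auto simp: is_ideal_def)
  show "a * r \<in> I" if "a \<in> I" for a r using *(3)[OF that, of r] by (simp add: mult.commute[of a r])
  show neg: "- a \<in> I" if "a \<in> I" for a using *(3)[OF that, of "- 1"] by simp
  show "a - b \<in> I" if "a \<in> I" "b \<in> I" for a b using *(2)[OF that(1) neg[OF that(2)]] by simp
qed

lemma is_prime_idealD:
  assumes "is_prime_ideal P"
  shows "is_ideal P" "1 \<notin> P" "a * b \<in> P \<Longrightarrow> a \<in> P \<or> b \<in> P"
  using assms by (auto simp: is_prime_ideal_def)

lemma cring_type_ring: "cring (type_ring :: 'a::comm_ring_1 ring)"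
proof (rule cringI)
  show "abelian_group (type_ring :: 'a ring)"
    by (rule abelian_groupI) (auto simp: algebra_simps intro: exI[of _ "- x" for x])
  show "Group.comm_monoid (type_ring :: 'a ring)"
    by (rule comm_monoidI) (auto simp: algebra_simps)
qed (auto simp: algebra_simps)

lemma ideal_type_ring_iff: "ideal I type_ring \<longleftrightarrow> is_ideal I"
proof
  assume "ideal I type_ring"
  then interpret ideal I type_ring .
  have "a + b \<in> I" if "a \<in> I" "b \<in> I" for a b
    using additive_subgroup.a_closed[OF additive_subgroup_axioms that] by simp
  moreover have "r * a \<in> I" if "a \<in> I" for a r
    using I_l_closed[OF that, of r] by simp
  ultimately show "is_ideal I"
    using additive_subgroup.zero_closed[OF additive_subgroup_axioms] by (simp add: is_ideal_def)
next
  assume I: "is_ideal I"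
  interpret R: cring "type_ring :: 'a ring" by (rule cring_type_ring)
  show "ideal I type_ring"
  proof (rule idealI)
    show "subgroup I (add_monoid type_ring)"
    proof (rule R.add.subgroupI)
      show "I \<noteq> {}" using is_idealD(1)[OF I] by blast
      show "\<ominus>\<^bsub>type_ring\<^esub> a \<in> I" if "a \<in> I" for a
      proof -
        have "\<ominus>\<^bsub>type_ring\<^esub> a = - a"
          using R.minus_equality[of "- a" a] by simp
        then show ?thesis using is_idealD(5)[OF I that] by simp
      qed
    qed (use is_idealD[OF I] in auto)
  qed (use is_idealD[OF I] R.ring_axioms in auto)
qed

lemma primeideal_type_ring_iff: "primeideal P type_ring \<longleftrightarrow> is_prime_ideal P"
proof
  assume "primeideal P type_ring"
  then interpret primeideal P type_ring .
  have "1 \<notin> P" using one_imp_carrier I_notcarr by auto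
  then show "is_prime_ideal P"
    using ideal_axioms I_prime by (auto simp: is_prime_ideal_def ideal_type_ring_iff)
next
  assume "is_prime_ideal P"
  then show "primeideal P type_ring"
    by (intro primeidealI cring_type_ring) (auto simp: ideal_type_ring_iff is_prime_ideal_def)
qed

lemma (in cring) primeideal_Union_quot:
  assumes I: "ideal I R" and P: "primeideal P (R Quot I)"
  shows "primeideal (\<Union>P) R"
proof -
  interpret P: primeideal P "R Quot I" by (rule P)
  have sub: "P \<subseteq> carrier (R Quot I)" by (rule P.a_subset)
  have "\<Union>P = {r \<in> carrier R. I +> r \<in> P}"
    using canonical_proj_vimage_in_carrier[OF I sub] canonical_proj_vimage_mem_iff[OF I sub] by blast
  then show ?thesis
    using ring_hom_ring.primeideal_vimage[OF ideal.rcos_ring_hom_ring[OF I] is_cring P] by simp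
qed

lemma (in cring) primeideal_image_quot:
  assumes I: "ideal I R" and P: "primeideal P R" and IP: "I \<subseteq> P"
  shows "primeideal ((+>) I ` P) (R Quot I)"
proof -
  interpret I: ideal I R by (rule I)
  interpret P: primeideal P R by (rule P)
  let ?J = "(+>) I ` P"
  have J: "ideal ?J (R Quot I)" by (rule ring_ideal_imp_quot_ideal[OF I P.ideal_axioms])
  have sub: "?J \<subseteq> carrier (R Quot I)" by (rule additive_subgroup.a_subset[OF ideal.axioms(1)[OF J]])
  have "\<Union>?J = P" using ideal_incl_iff[OF I P.ideal_axioms] IP by blast
  then have mem: "I +> a \<in> ?J \<longleftrightarrow> a \<in> P" if "a \<in> carrier R" for a
    using canonical_proj_vimage_mem_iff[OF I sub that] by simp
  have carr: "carrier (R Quot I) = (+>) I ` carrier R"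
    by (auto simp: FactRing_def A_RCOSETS_def')
  show ?thesis
  proof (rule primeidealI[OF J I.quotient_is_cring[OF is_cring]])
    have "\<one> \<notin> P" using P.one_imp_carrier P.I_notcarr by auto
    then show "carrier (R Quot I) \<noteq> ?J" using mem[of \<one>] carr one_closed by blast
    show "x \<in> ?J \<or> y \<in> ?J"
      if xy: "x \<in> carrier (R Quot I)" "y \<in> carrier (R Quot I)" "x \<otimes>\<^bsub>R Quot I\<^esub> y \<in> ?J" for x y
    proof -
      obtain a b where ab: "a \<in> carrier R" "b \<in> carrier R" "x = I +> a" "y = I +> b"
        using xy(1,2) carr by auto
      then have "x \<otimes>\<^bsub>R Quot I\<^esub> y = I +> (a \<otimes> b)"
        by (simp add: FactRing_def I.rcoset_mult_add)
      then have "a \<otimes> b \<in> P" using xy(3) ab mem by auto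
      then show ?thesis using P.I_prime ab mem by auto
    qed
  qed
qed

text \<open>
  A chain \<open>P 0 \<subset> \<dots> \<subset> P n\<close> of length \<open>n\<close> of prime ideals containing \<open>I\<close>. Values of \<open>P\<close> beyond
  \<open>n\<close> are irrelevant.
\<close>

definition prime_chain :: "'a::comm_ring_1 set \<Rightarrow> nat \<Rightarrow> (nat \<Rightarrow> 'a set) \<Rightarrow> bool"
  where "prime_chain I n P \<longleftrightarrow>
    I \<subseteq> P 0 \<and> (\<forall>i\<le>n. is_prime_ideal (P i)) \<and> (\<forall>i<n. P i \<subset> P (Suc i))"

lemma prime_chain_subset:
  assumes "prime_chain I n P" "i \<le> n"
  shows "I \<subseteq> P i"
  using assms(2)
proof (induction i)
  case 0
  then show ?case using assms(1) by (auto simp: prime_chain_def)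
next
  case (Suc i)
  then show ?case using assms(1) by (auto simp: prime_chain_def dest!: spec[of _ i])
qed

text \<open>
  By the correspondence of ideals, the dimension of a quotient is measured by chains of primes
  upstairs.
\<close>

lemma krull_dim_Quot:
  assumes I: "is_ideal I"
  shows "krull_dim (type_ring Quot I) = (SUP n \<in> {n. \<exists>P. prime_chain I n P}. ereal (real n))"
proof -
  interpret R: cring "type_ring :: 'a ring" by (rule cring_type_ring)
  have I': "ideal I type_ring" using I by (simp add: ideal_type_ring_iff)
  let ?q = "\<lambda>J. (+>\<^bsub>type_ring\<^esub>) I ` J"
  have bij: "bij_betw ?q {J. ideal J type_ring \<and> I \<subseteq> J} {J. ideal J (type_ring Quot I)}"
    by (rule R.quot_ideal_correspondence[OF I'])
  have "(\<exists>Q. (\<forall>i\<le>n. primeideal (Q i) (type_ring Quot I)) \<and> (\<forall>i<n. Q i \<subset> Q (Suc i)))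
      \<longleftrightarrow> (\<exists>P. prime_chain I n P)" (is "?L \<longleftrightarrow> ?R") for n
  proof
    assume ?L
    then obtain Q where Q: "\<And>i. i \<le> n \<Longrightarrow> primeideal (Q i) (type_ring Quot I)"
      "\<And>i. i < n \<Longrightarrow> Q i \<subset> Q (Suc i)" by blast
    have idl: "ideal (Q i) (type_ring Quot I)" if "i \<le> n" for i
      using Q(1)[OF that] by (simp add: primeideal_def)
    have sub: "Q i \<subseteq> carrier (type_ring Quot I)" if "i \<le> n" for i
      by (rule additive_subgroup.a_subset[OF ideal.axioms(1)[OF idl[OF that]]])
    have prime: "is_prime_ideal (\<Union>(Q i))" if "i \<le> n" for i
      using R.primeideal_Union_quot[OF I' Q(1)[OF that]] by (simp add: primeideal_type_ring_iff)
    have strict: "\<Union>(Q i) \<subset> \<Union>(Q (Suc i))" if i: "i < n" for i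
    proof -
      obtain x where x: "x \<in> Q (Suc i)" "x \<notin> Q i" using Q(2)[OF i] by blast
      have "x \<in> carrier (type_ring Quot I)" using sub[of "Suc i"] i x by auto
      then obtain r where r: "x = I +>\<^bsub>type_ring\<^esub> r"
        by (auto simp: FactRing_def A_RCOSETS_def')
      have "r \<in> \<Union>(Q (Suc i))" "r \<notin> \<Union>(Q i)"
        using R.canonical_proj_vimage_mem_iff[OF I' sub, of _ r] i x r by auto
      moreover have "\<Union>(Q i) \<subseteq> \<Union>(Q (Suc i))" using Q(2)[OF i] by blast
      ultimately show ?thesis by blast
    qed
    have "I \<in> Q 0"
      using additive_subgroup.zero_closed[OF ideal.axioms(1)[OF idl[of 0]]] by (simp add: FactRing_def)
    then have "prime_chain I n (\<lambda>i. \<Union>(Q i))"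
      using prime strict by (auto simp: prime_chain_def)
    then show ?R by blast
  next
    assume ?R
    then obtain P where P: "prime_chain I n P" by blast
    have IP: "I \<subseteq> P i" if "i \<le> n" for i by (rule prime_chain_subset[OF P that])
    have prime: "primeideal (P i) type_ring" if "i \<le> n" for i
      using P that by (auto simp: prime_chain_def primeideal_type_ring_iff)
    have "primeideal (?q (P i)) (type_ring Quot I)" if "i \<le> n" for i
      by (rule R.primeideal_image_quot[OF I' prime[OF that] IP[OF that]])
    moreover have "?q (P i) \<subset> ?q (P (Suc i))" if i: "i < n" for i
    proof -
      have "P i \<in> {J. ideal J type_ring \<and> I \<subseteq> J}" "P (Suc i) \<in> {J. ideal J type_ring \<and> I \<subseteq> J}"
        using prime[of i] prime[of "Suc i"] IP[of i] IP[of "Suc i"] i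
        by (auto simp: primeideal_def)
      moreover have "P i \<subset> P (Suc i)" using P i by (auto simp: prime_chain_def)
      ultimately have "?q (P i) \<noteq> ?q (P (Suc i))"
        using inj_onD[OF bij_betw_imp_inj_on[OF bij]] by blast
      with \<open>P i \<subset> P (Suc i)\<close> show ?thesis by blast
    qed
    ultimately show ?L by (intro exI[of _ "\<lambda>i. ?q (P i)"]) blast
  qed
  then show ?thesis by (simp add: krull_dim_def)
qed

text \<open>
  Passing from a prime ideal \<open>I\<close> to a strictly larger ideal \<open>J\<close> lowers a finite dimension of the
  quotient, since \<open>I\<close> can be put in front of every chain of primes above \<open>J\<close>.
\<close>

lemma krull_dim_Quot_strict:
  assumes I: "is_prime_ideal I" and J: "is_ideal J" and IJ: "I \<subset> J"
    and dimJ: "krull_dim (type_ring Quot J) = ereal r"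
  shows "krull_dim (type_ring Quot I) \<noteq> ereal r"
proof
  assume dimI: "krull_dim (type_ring Quot I) = ereal r"
  have "ereal (r - 1) < krull_dim (type_ring Quot J)" using dimJ by simp
  then obtain n P where nP: "prime_chain J n P" "r - 1 < real n"
    by (auto simp: krull_dim_Quot[OF J] less_SUP_iff)
  have "prime_chain I (Suc n) (case_nat I P)"
    using nP(1) I IJ by (auto simp: prime_chain_def split: nat.splits)
  then have "ereal (real (Suc n)) \<le> krull_dim (type_ring Quot I)"
    unfolding krull_dim_Quot[OF is_prime_idealD(1)[OF I]] by (intro SUP_upper) blast
  with dimI nP(2) show False by simp
qed

section \<open>Prime chains in extensions with an involution\<close>

text \<open>
  A ring homomorphism \<open>\<phi>\<close> whose target carries an involution \<open>\<sigma>\<close> fixing the image of \<open>\<phi>\<close>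
  pointwise, such that all traces \<open>x + \<sigma> x\<close> and norms \<open>x * \<sigma> x\<close> lie in this image. Every \<open>x\<close>
  is then a root of the monic polynomial \<open>T\<^sup>2 - (x + \<sigma> x) T + x * \<sigma> x\<close>, so the target is
  integral over the image. Injectivity of \<open>\<phi>\<close> is not assumed.
\<close>

locale involutive_extension =
  fixes \<phi> :: "'a::comm_ring_1 \<Rightarrow> 'b::comm_ring_1" and \<sigma> :: "'b \<Rightarrow> 'b"
  assumes \<phi>_add: "\<phi> (a + b) = \<phi> a + \<phi> b" and \<phi>_mult: "\<phi> (a * b) = \<phi> a * \<phi> b" and \<phi>_one: "\<phi> 1 = 1"
    and \<sigma>_add: "\<sigma> (x + y) = \<sigma> x + \<sigma> y" and \<sigma>_mult: "\<sigma> (x * y) = \<sigma> x * \<sigma> y"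
    and \<sigma>_\<sigma>: "\<sigma> (\<sigma> x) = x" and \<sigma>_\<phi>: "\<sigma> (\<phi> a) = \<phi> a"
    and trace: "x + \<sigma> x \<in> range \<phi>" and norm: "x * \<sigma> x \<in> range \<phi>"
begin

abbreviation contract :: "'b set \<Rightarrow> 'a set" where "contract K \<equiv> \<phi> -` K"

lemma \<phi>_zero: "\<phi> 0 = 0"
  using \<phi>_add[of 0 0] by simp

lemma \<phi>_diff: "\<phi> (a - b) = \<phi> a - \<phi> b"
  using \<phi>_add[of "a - b" b] by simp

lemma \<sigma>_diff: "\<sigma> (a - b) = \<sigma> a - \<sigma> b"
  using \<sigma>_add[of "a - b" b] by simp

lemma is_ideal_contract: "is_ideal K \<Longrightarrow> is_ideal (contract K)"
  by (auto simp: is_ideal_def \<phi>_zero \<phi>_add \<phi>_mult)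

lemma is_prime_ideal_contract: "is_prime_ideal P \<Longrightarrow> is_prime_ideal (contract P)"
  using is_ideal_contract[of P] by (auto simp: is_prime_ideal_def \<phi>_one \<phi>_mult)

lemma incomparability:
  assumes P: "is_prime_ideal P" and Q: "is_prime_ideal Q" and PQ: "P \<subset> Q"
  shows "contract P \<subset> contract Q"
proof -
  have "contract P \<noteq> contract Q"
  proof
    assume eq: "contract P = contract Q"
    have down: "y \<in> P" if "y \<in> Q" "y \<in> range \<phi>" for y using that eq by auto
    obtain x where x: "x \<in> Q" "x \<notin> P" using PQ by blast
    have "x * \<sigma> x \<in> P" using down norm is_idealD(4)[OF is_prime_idealD(1)[OF Q] x(1)] by blast
    then have sx: "\<sigma> x \<in> P" using is_prime_idealD(3)[OF P] x(2) by blast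
    then have "x + \<sigma> x \<in> P"
      using down trace is_idealD(2)[OF is_prime_idealD(1)[OF Q] x(1)] PQ by blast
    then have "x \<in> P" using is_idealD(6)[OF is_prime_idealD(1)[OF P] _ sx] by fastforce
    with x(2) show False ..
  qed
  with PQ show ?thesis by blast
qed

text \<open>
  Every ideal \<open>K\<close> whose contraction lies in the prime \<open>p\<close> is contained in a prime lying over \<open>p\<close>,
  namely in any ideal that is maximal among those containing \<open>K\<close> and the image of \<open>p\<close> and whose
  contraction lies in \<open>p\<close>.
\<close>

lemma going_up:
  assumes K: "is_ideal K" and p: "is_prime_ideal p" and Kp: "contract K \<subseteq> p"
  shows "\<exists>P. is_prime_ideal P \<and> K \<subseteq> P \<and> contract P = p"
proof -
  note pI = is_idealD[OF is_prime_idealD(1)[OF p]] and KI = is_idealD[OF K]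
  \<comment> \<open>\<open>E\<close> contains the ideal generated by the image of \<open>p\<close>; traces and norms of its
    elements come from \<open>p\<close>.\<close>
  define E where
    "E = {h. (\<forall>b. h * b + \<sigma> (h * b) \<in> \<phi> ` p) \<and> h * \<sigma> h \<in> \<phi> ` p}"
  have add_p: "x + y \<in> \<phi> ` p" if "x \<in> \<phi> ` p" "y \<in> \<phi> ` p" for x y
    using that pI(2) by (auto simp: \<phi>_add[symmetric])
  have E: "is_ideal E"
    unfolding is_ideal_def
  proof (intro conjI ballI allI)
    have "\<sigma> 0 = 0" using \<sigma>_add[of 0 0] by simp
    then show "0 \<in> E" using pI(1) \<phi>_zero by (auto simp: E_def intro: image_eqI[of _ _ 0])
  next
    fix x y assume x: "x \<in> E" and y: "y \<in> E"
    have "(x + y) * b + \<sigma> ((x + y) * b) = (x * b + \<sigma> (x * b)) + (y * b + \<sigma> (y * b))" for b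
      by (simp add: \<sigma>_add \<sigma>_mult algebra_simps)
    moreover have "(x + y) * \<sigma> (x + y) = (x * \<sigma> x + y * \<sigma> y) + (x * \<sigma> y + \<sigma> (x * \<sigma> y))"
      by (simp add: \<sigma>_add \<sigma>_mult \<sigma>_\<sigma> algebra_simps)
    ultimately show "x + y \<in> E" using x y unfolding E_def mem_Collect_eq by (metis add_p)
  next
    fix x r assume x: "x \<in> E"
    obtain a where a: "r * \<sigma> r = \<phi> a" using norm by blast
    obtain c where c: "c \<in> p" "x * \<sigma> x = \<phi> c" using x by (auto simp: E_def)
    have "r * x * b + \<sigma> (r * x * b) \<in> \<phi> ` p" for b
    proof -
      have eq: "r * x * b = x * (r * b)" by (simp add: algebra_simps)
      show ?thesis unfolding eq using x by (simp add: E_def)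
    qed
    moreover have "r * x * \<sigma> (r * x) = \<phi> (a * c)"
      by (simp add: \<sigma>_mult \<phi>_mult a[symmetric] c(2)[symmetric] algebra_simps)
    ultimately show "r * x \<in> E" using pI(3)[OF c(1)] by (auto simp: E_def)
  qed
  have pE: "\<phi> a \<in> E" if a: "a \<in> p" for a
  proof -
    have "\<phi> a * b + \<sigma> (\<phi> a * b) \<in> \<phi> ` p" for b
    proof -
      obtain t where "b + \<sigma> b = \<phi> t" using trace by blast
      then have "\<phi> a * b + \<sigma> (\<phi> a * b) = \<phi> (t * a)"
        by (simp add: \<sigma>_mult \<sigma>_\<phi> \<phi>_mult mult.commute[of _ "\<phi> a"] flip: distrib_left)
      then show ?thesis using pI(3)[OF a] by blast
    qed
    moreover have "\<phi> a * \<sigma> (\<phi> a) = \<phi> (a * a)" by (simp add: \<sigma>_\<phi> \<phi>_mult)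
    ultimately show ?thesis using pI(3)[OF a] by (auto simp: E_def)
  qed
  define S where "S = {M. is_ideal M \<and> K \<subseteq> M \<and> E \<subseteq> M \<and> contract M \<subseteq> p}"
  define M0 where "M0 = {g + h |g h. g \<in> K \<and> h \<in> E}"
  have M0: "M0 \<in> S"
  proof -
    have "is_ideal M0"
      unfolding is_ideal_def
    proof (intro conjI ballI allI)
      show "0 \<in> M0" using KI(1) is_idealD(1)[OF E] by (force simp: M0_def)
    next
      fix x y assume "x \<in> M0" "y \<in> M0"
      then obtain g h g' h' where "x = g + h" "y = g' + h'" "g \<in> K" "g' \<in> K" "h \<in> E" "h' \<in> E"
        by (auto simp: M0_def)
      moreover from this have "x + y = (g + g') + (h + h')" by simp
      ultimately show "x + y \<in> M0" using KI(2) is_idealD(2)[OF E] unfolding M0_def by blast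
    next
      fix x r assume "x \<in> M0"
      then obtain g h where "x = g + h" "g \<in> K" "h \<in> E" by (auto simp: M0_def)
      moreover from this have "r * x = r * g + r * h" by (simp add: distrib_left)
      ultimately show "r * x \<in> M0" using KI(3) is_idealD(3)[OF E] unfolding M0_def by blast
    qed
    moreover have "K \<subseteq> M0" using is_idealD(1)[OF E] by (force simp: M0_def)
    moreover have "E \<subseteq> M0" using KI(1) by (force simp: M0_def)
    moreover have "contract M0 \<subseteq> p"
    proof
      \<comment> \<open>If \<open>\<phi> f = g + h\<close>, then the norm of \<open>g = \<phi> f - h\<close> lies in \<open>K\<close> and has the form
        \<open>f\<^sup>2 - f * a + c\<close> with \<open>a\<close> and \<open>c\<close> in \<open>p\<close>.\<close>
      fix f assume "f \<in> contract M0"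
      then obtain g h where gh: "\<phi> f = g + h" "g \<in> K" "h \<in> E" by (auto simp: M0_def)
      obtain a where a: "a \<in> p" "h + \<sigma> h = \<phi> a"
        using gh(3) by (auto simp: E_def dest!: spec[of _ 1])
      obtain c where c: "c \<in> p" "h * \<sigma> h = \<phi> c" using gh(3) by (auto simp: E_def)
      have "\<phi> f - \<sigma> h = \<sigma> (\<phi> f - h)" by (simp add: \<sigma>_diff \<sigma>_\<phi>)
      then have "g * \<sigma> g = (\<phi> f - h) * (\<phi> f - \<sigma> h)" using gh(1) by simp
      also have "\<dots> = \<phi> f * \<phi> f - \<phi> f * (h + \<sigma> h) + h * \<sigma> h" by (simp add: algebra_simps)
      also have "\<dots> = \<phi> (f * f - f * a + c)" by (simp add: a(2) c(2) \<phi>_add \<phi>_diff \<phi>_mult)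
      finally have "\<phi> (f * f - f * a + c) \<in> K" using KI(4)[OF gh(2)] by metis
      then have "f * f - f * a + c \<in> p" using Kp by blast
      then have "f * f - f * a + c - c + f * a \<in> p" using a(1) c(1) pI(2,3,6) by blast
      then have "f * f \<in> p" by simp
      then show "f \<in> p" using is_prime_idealD(3)[OF p] by blast
    qed
    ultimately show ?thesis by (auto simp: S_def)
  qed
  \<comment> \<open>A maximal element of \<open>S\<close> is the required prime.\<close>
  have "\<exists>M\<in>S. \<forall>X\<in>S. M \<subseteq> X \<longrightarrow> X = M"
  proof (rule subset_Zorn_nonempty)
    show "S \<noteq> {}" using M0 by blast
  next
    fix C assume C: "C \<noteq> {}" "subset.chain S C"
    then have CS: "M \<in> C \<Longrightarrow> M \<in> S" for M by (auto simp: subset.chain_def)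
    have CI: "M \<in> C \<Longrightarrow> is_ideal M" for M using CS by (auto simp: S_def)
    have "is_ideal (\<Union>C)"
      unfolding is_ideal_def
    proof (intro conjI ballI allI)
      show "0 \<in> \<Union>C" using C(1) CI is_idealD(1) by blast
    next
      fix x y assume "x \<in> \<Union>C" "y \<in> \<Union>C"
      then obtain M N where MN: "M \<in> C" "N \<in> C" "x \<in> M" "y \<in> N" by blast
      have "M \<subseteq> N \<or> N \<subseteq> M" using C(2) MN(1,2) by (auto simp: subset_chain_def)
      then show "x + y \<in> \<Union>C" using MN is_idealD(2)[OF CI[OF MN(1)]] is_idealD(2)[OF CI[OF MN(2)]] by blast
    next
      fix x r assume "x \<in> \<Union>C"
      then show "r * x \<in> \<Union>C" using CI is_idealD(3) by blast
    qed
    then show "\<Union>C \<in> S" using C(1) CS unfolding S_def by blast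
  qed
  then obtain M where M: "M \<in> S" and max: "\<And>X. X \<in> S \<Longrightarrow> M \<subseteq> X \<Longrightarrow> X = M" by blast
  have MI: "is_ideal M" using M by (simp add: S_def)
  have witness: "\<exists>s m r. s \<notin> p \<and> m \<in> M \<and> \<phi> s = m + r * x" if x: "x \<notin> M" for x
  proof -
    let ?N = "{m + r * x |m r. m \<in> M}"
    have "is_ideal ?N"
      unfolding is_ideal_def
    proof (intro conjI ballI allI)
      show "0 \<in> ?N" using is_idealD(1)[OF MI] by (auto intro!: exI[of _ 0])
    next
      fix u v assume "u \<in> ?N" "v \<in> ?N"
      then obtain m r m' r' where "u = m + r * x" "v = m' + r' * x" "m \<in> M" "m' \<in> M" by blast
      moreover from this have "u + v = (m + m') + (r + r') * x" by (simp add: algebra_simps)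
      ultimately show "u + v \<in> ?N" using is_idealD(2)[OF MI] by blast
    next
      fix u s assume "u \<in> ?N"
      then obtain m r where "u = m + r * x" "m \<in> M" by blast
      moreover from this have "s * u = s * m + (s * r) * x" by (simp add: algebra_simps)
      ultimately show "s * u \<in> ?N" using is_idealD(3)[OF MI] by blast
    qed
    moreover have "M \<subseteq> ?N"
    proof
      fix m assume m: "m \<in> M"
      have "m = m + 0 * x" by simp
      with m show "m \<in> ?N" by blast
    qed
    moreover have "x \<in> ?N"
    proof -
      have "x = 0 + 1 * x" by simp
      with is_idealD(1)[OF MI] show ?thesis by blast
    qed
    ultimately have "?N \<notin> S" using max x by blast
    then have "\<not> contract ?N \<subseteq> p"
      using \<open>is_ideal ?N\<close> \<open>M \<subseteq> ?N\<close> M unfolding S_def by blast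
    then show ?thesis by blast
  qed
  have "is_prime_ideal M"
    unfolding is_prime_ideal_def
  proof (intro conjI allI impI MI)
    have "contract M \<subseteq> p" using M by (simp add: S_def)
    then show "1 \<notin> M" using is_prime_idealD(2)[OF p] \<phi>_one by (metis subsetD vimageI)
  next
    fix x y assume xy: "x * y \<in> M"
    show "x \<in> M \<or> y \<in> M"
    proof (rule ccontr)
      assume "\<not> (x \<in> M \<or> y \<in> M)"
      then obtain s m r s' m' r' where *: "s \<notin> p" "m \<in> M" "\<phi> s = m + r * x"
        "s' \<notin> p" "m' \<in> M" "\<phi> s' = m' + r' * y" using witness by meson
      have "\<phi> (s * s') = m * (m' + r' * y) + r * x * m' + r * r' * (x * y)"
        by (simp add: \<phi>_mult *(3,6) algebra_simps)
      also have "\<dots> \<in> M"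
        by (intro is_idealD(2)[OF MI] is_idealD(4)[OF MI *(2)] is_idealD(3)[OF MI *(5)]
            is_idealD(3)[OF MI xy])
      finally have "s * s' \<in> p" using M by (auto simp: S_def)
      then show False using is_prime_idealD(3)[OF p] *(1,4) by blast
    qed
  qed
  moreover have "contract M = p" using M pE by (auto simp: S_def)
  ultimately show ?thesis using M by (auto simp: S_def)
qed

lemma prime_chain_lift:
  assumes K: "is_ideal K" and "prime_chain (contract K) n p"
  shows "\<exists>P. prime_chain K n P \<and> contract (P n) = p n"
  using assms(2)
proof (induction n)
  case 0
  then obtain Q where "is_prime_ideal Q" "K \<subseteq> Q" "contract Q = p 0"
    using going_up[OF K, of "p 0"] by (auto simp: prime_chain_def)
  then show ?case by (intro exI[of _ "\<lambda>_. Q"]) (simp add: prime_chain_def)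
next
  case (Suc n)
  then obtain P where P: "prime_chain K n P" "contract (P n) = p n"
    by (auto simp: prime_chain_def)
  have p: "is_prime_ideal (p (Suc n))" "p n \<subset> p (Suc n)" using Suc.prems by (auto simp: prime_chain_def)
  have "is_ideal (P n)" using P(1) by (auto simp: prime_chain_def is_prime_ideal_def)
  then obtain Q where Q: "is_prime_ideal Q" "P n \<subseteq> Q" "contract Q = p (Suc n)"
    using going_up[OF _ p(1), of "P n"] P(2) p(2) by blast
  have "P n \<noteq> Q" using Q(3) P(2) p(2) by blast
  then have "prime_chain K (Suc n) (\<lambda>i. if i \<le> n then P i else Q)"
    using P(1) Q(1,2) unfolding prime_chain_def by (simp add: less_Suc_eq le_Suc_eq psubset_eq)
  moreover have "contract (if Suc n \<le> n then P (Suc n) else Q) = p (Suc n)" using Q(3) by simp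
  ultimately show ?case by (rule_tac exI[of _ "\<lambda>i. if i \<le> n then P i else Q"]) (rule conjI)
qed

theorem krull_dim_contract:
  assumes K: "is_ideal K"
  shows "krull_dim (type_ring Quot K) = krull_dim (type_ring Quot (contract K))"
proof -
  have "(\<exists>P. prime_chain K n P) \<longleftrightarrow> (\<exists>p. prime_chain (contract K) n p)" for n
  proof
    assume "\<exists>P. prime_chain K n P"
    then obtain P where P: "prime_chain K n P" ..
    then have "prime_chain (contract K) n (\<lambda>i. contract (P i))"
      using incomparability is_prime_ideal_contract by (auto simp: prime_chain_def)
    then show "\<exists>p. prime_chain (contract K) n p" by blast
  qed (use prime_chain_lift[OF K] in blast)
  then show ?thesis by (simp add: krull_dim_Quot K is_ideal_contract)
qed

end

section \<open>Evaluation and homogeneous components\<close>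

abbreviation total_degree :: "('n::finite \<Rightarrow>\<^sub>0 nat) \<Rightarrow> nat"
  where "total_degree m \<equiv> (\<Sum>i\<in>UNIV. Poly_Mapping.lookup m i)"

lemma poly_mapping_eq_sum_single:
  fixes f :: "'a \<Rightarrow>\<^sub>0 'b::comm_monoid_add"
  shows "f = (\<Sum>m\<in>Poly_Mapping.keys f. Poly_Mapping.single m (Poly_Mapping.lookup f m))"
  by (rule poly_mapping_eqI)
    (auto simp: lookup_sum lookup_single when_def not_in_keys_iff_lookup_eq_zero sum.delta)

lemma poly_mapping_single_induct [case_names single add]:
  fixes f :: "'a \<Rightarrow>\<^sub>0 'b::comm_monoid_add"
  assumes single: "\<And>m c. P (Poly_Mapping.single m c)"
    and add: "\<And>f g. P f \<Longrightarrow> P g \<Longrightarrow> P (f + g)"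
  shows "P f"
proof -
  have "P 0" using single[of undefined 0] by simp
  have "finite A \<Longrightarrow> P (\<Sum>m\<in>A. Poly_Mapping.single m (Poly_Mapping.lookup f m))" for A
    by (induction A rule: finite_induct) (auto simp: \<open>P 0\<close> single add)
  from this[OF finite_keys[of f]] show ?thesis by (simp flip: poly_mapping_eq_sum_single)
qed

lemma eval_mpoly_superset:
  assumes "finite A" "Poly_Mapping.keys f \<subseteq> A"
  shows "eval_mpoly f v =
    (\<Sum>m\<in>A. Poly_Mapping.lookup f m * (\<Prod>i\<in>UNIV. (v $ i) ^ Poly_Mapping.lookup m i))"
  unfolding eval_mpoly_def using assms
  by (intro sum.mono_neutral_left) (auto simp: not_in_keys_iff_lookup_eq_zero)

lemma eval_mpoly_add: "eval_mpoly (f + g) v = eval_mpoly f v + eval_mpoly g v"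
proof -
  let ?A = "Poly_Mapping.keys f \<union> Poly_Mapping.keys g"
  show ?thesis
    using Poly_Mapping.keys_add[of f g]
    by (simp add: eval_mpoly_superset[of ?A] lookup_add distrib_right sum.distrib)
qed

lemma eval_mpoly_single:
  "eval_mpoly (Poly_Mapping.single m c) v = c * (\<Prod>i\<in>UNIV. (v $ i) ^ Poly_Mapping.lookup m i)"
  by (subst eval_mpoly_superset[of "{m}"]) auto

lemma eval_mpoly_0 [simp]: "eval_mpoly 0 v = 0"
  by (simp add: eval_mpoly_def)

lemma eval_mpoly_1 [simp]: "eval_mpoly 1 v = 1"
  by (simp flip: single_one add: eval_mpoly_single)

lemma eval_mpoly_mult: "eval_mpoly (f * g) v = eval_mpoly f v * eval_mpoly g v"
proof (induction f rule: poly_mapping_single_induct)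
  case (single m c)
  show ?case
    by (induction g rule: poly_mapping_single_induct)
      (simp_all add: mult_single eval_mpoly_single eval_mpoly_add lookup_add power_add prod.distrib
        algebra_simps)
qed (simp add: distrib_right eval_mpoly_add)

lemma is_ideal_vanishing_ideal: "is_ideal (vanishing_ideal V)"
  by (auto simp: is_ideal_def vanishing_ideal_def eval_mpoly_add eval_mpoly_mult)

text \<open>
  The polynomial consisting of a single variable.
\<close>

definition var_mpoly :: "'n \<Rightarrow> ('k::comm_ring_1, 'n::finite) mpoly"
  where "var_mpoly i = Poly_Mapping.single (Poly_Mapping.single i 1) 1"

lemma eval_var_mpoly [simp]: "eval_mpoly (var_mpoly i) v = v $ i"
proof -
  have "(\<Prod>j\<in>UNIV. (v $ j) ^ Poly_Mapping.lookup (Poly_Mapping.single i (1::nat)) j)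
      = (\<Prod>j\<in>UNIV. if i = j then v $ i else 1)"
    by (intro prod.cong) (auto simp: lookup_single when_def)
  then show ?thesis by (simp add: var_mpoly_def eval_mpoly_single)
qed

lemma homogeneous_var_mpoly: "homogeneous_mpoly (var_mpoly i :: ('k::comm_ring_1, 'n::finite) mpoly)"
  by (auto simp: homogeneous_mpoly_def var_mpoly_def)

lemma homogeneous_mult:
  assumes "homogeneous_mpoly f" "homogeneous_mpoly g"
  shows "homogeneous_mpoly (f * g :: ('k::comm_ring_1, 'n::finite) mpoly)"
proof -
  obtain d e where "\<forall>m\<in>Poly_Mapping.keys f. total_degree m = d"
    "\<forall>m\<in>Poly_Mapping.keys g. total_degree m = e"
    using assms by (auto simp: homogeneous_mpoly_def)
  then have "\<forall>m\<in>Poly_Mapping.keys (f * g). total_degree m = d + e"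
    using keys_mult[of f g] by (fastforce simp: lookup_add sum.distrib)
  then show ?thesis by (auto simp: homogeneous_mpoly_def)
qed

text \<open>
  The sum of the terms of degree \<open>d\<close>.
\<close>

definition homogeneous_component ::
    "nat \<Rightarrow> ('k::comm_ring_1, 'n::finite) mpoly \<Rightarrow> ('k, 'n) mpoly"
  where "homogeneous_component d f = Poly_Mapping.mapp (\<lambda>m c. c when total_degree m = d) f"

lemma lookup_homogeneous_component:
  "Poly_Mapping.lookup (homogeneous_component d f) m
    = (Poly_Mapping.lookup f m when total_degree m = d)"
  by (auto simp: homogeneous_component_def lookup_mapp when_def not_in_keys_iff_lookup_eq_zero)

lemma keys_homogeneous_component:
  "Poly_Mapping.keys (homogeneous_component d f) = {m \<in> Poly_Mapping.keys f. total_degree m = d}"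
  by (auto simp: in_keys_iff lookup_homogeneous_component)

lemma homogeneous_homogeneous_component: "homogeneous_mpoly (homogeneous_component d f)"
  by (auto simp: homogeneous_mpoly_def keys_homogeneous_component)

text \<open>
  The restriction of \<open>f\<close> to the line spanned by \<open>v\<close>, as a polynomial in one parameter. Its
  coefficients are the values at \<open>v\<close> of the homogeneous components of \<open>f\<close>, so over an infinite
  field \<open>f\<close> vanishes on the line exactly if all its components vanish at \<open>v\<close>.
\<close>

definition line_poly :: "('k::comm_ring_1, 'n::finite) mpoly \<Rightarrow> 'k ^ 'n \<Rightarrow> 'k poly"
  where "line_poly f v = (\<Sum>m\<in>Poly_Mapping.keys f.
    monom (Poly_Mapping.lookup f m * (\<Prod>i\<in>UNIV. (v $ i) ^ Poly_Mapping.lookup m i)) (total_degree m))"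

lemma poly_line_poly: "poly (line_poly f v) t = eval_mpoly f (t *s v)"
  unfolding line_poly_def eval_mpoly_def poly_sum
  by (intro sum.cong)
    (auto simp: poly_monom power_mult_distrib prod.distrib power_sum algebra_simps)

lemma coeff_line_poly: "coeff (line_poly f v) d = eval_mpoly (homogeneous_component d f) v"
proof -
  have "coeff (line_poly f v) d = (\<Sum>m\<in>Poly_Mapping.keys f. if total_degree m = d
      then Poly_Mapping.lookup f m * (\<Prod>i\<in>UNIV. (v $ i) ^ Poly_Mapping.lookup m i) else 0)"
    by (simp add: line_poly_def coeff_sum)
  also have "\<dots> = eval_mpoly (homogeneous_component d f) v"
    by (subst eval_mpoly_superset[of "Poly_Mapping.keys f"])
      (auto simp: keys_homogeneous_component lookup_homogeneous_component when_def intro!: sum.cong)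
  finally show ?thesis .
qed

lemma eval_eq_0_if_components:
  assumes "\<And>d. eval_mpoly (homogeneous_component d f) v = 0"
  shows "eval_mpoly f (t *s v) = 0"
proof -
  have "line_poly f v = 0" by (rule poly_eqI) (simp add: coeff_line_poly assms)
  then show ?thesis by (simp flip: poly_line_poly)
qed

lemma homogeneous_eval_scale:
  assumes "homogeneous_mpoly f"
  obtains d where "\<And>c v. eval_mpoly f (c *s v) = c ^ d * eval_mpoly f v"
proof -
  obtain d where d: "\<forall>m\<in>Poly_Mapping.keys f. total_degree m = d"
    using assms by (auto simp: homogeneous_mpoly_def)
  have "eval_mpoly f (c *s v) = c ^ d * eval_mpoly f v" for c v
    unfolding eval_mpoly_def sum_distrib_left
  proof (intro sum.cong refl)
    fix m assume "m \<in> Poly_Mapping.keys f"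
    then have "c ^ d = (\<Prod>i\<in>UNIV. c ^ Poly_Mapping.lookup m i)" using d by (simp flip: power_sum)
    then show "Poly_Mapping.lookup f m * (\<Prod>i\<in>UNIV. ((c *s v) $ i) ^ Poly_Mapping.lookup m i)
      = c ^ d * (Poly_Mapping.lookup f m * (\<Prod>i\<in>UNIV. (v $ i) ^ Poly_Mapping.lookup m i))"
      by (simp add: power_mult_distrib prod.distrib algebra_simps)
  qed
  then show ?thesis by (rule that)
qed

section \<open>Projective varieties and their cones\<close>

lemma proj_point_cases:
  obtains v where "v \<noteq> 0" "R = proj_point v"
  using Quotient3_rep_reflp[OF Quotient3_proj, of R] Quotient3_abs_rep[OF Quotient3_proj, of R]
  by (metis projrel_def)

lemma zero_in_affine_cone [simp]: "0 \<in> affine_cone X"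
  by (simp add: affine_cone_def)

lemma affine_cone_iff: "v \<noteq> 0 \<Longrightarrow> v \<in> affine_cone X \<longleftrightarrow> proj_point v \<in> X"
  by (simp add: affine_cone_def)

lemma affine_cone_scale: "v \<in> affine_cone X \<Longrightarrow> c *s v \<in> affine_cone X"
  using proj_point_eq_iff[of v "c *s v"] by (cases "c = 0"; cases "v = 0") (auto simp: affine_cone_def)

lemma affine_cone_mono: "X \<subseteq> Y \<Longrightarrow> affine_cone X \<subseteq> affine_cone Y"
  by (auto simp: affine_cone_def)

lemma proj_point_in_zero_locus:
  assumes S: "\<forall>f\<in>S. homogeneous_mpoly f" and v: "v \<noteq> 0"
  shows "proj_point v \<in> zero_locus S \<longleftrightarrow> (\<forall>f\<in>S. eval_mpoly f v = 0)"
proof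
  assume "proj_point v \<in> zero_locus S"
  then obtain w where w: "proj_point v = proj_point w" "w \<noteq> 0" "\<forall>f\<in>S. eval_mpoly f w = 0"
    by (auto simp: zero_locus_def)
  obtain c where "c \<noteq> 0" "v = c *s w" using w(1,2) v proj_point_eq_iff[of w v] by auto
  then show "\<forall>f\<in>S. eval_mpoly f v = 0"
    using w(3) S homogeneous_eval_scale by (metis mult_zero_right)
qed (use v in \<open>auto simp: zero_locus_def\<close>)

text \<open>
  The origin belongs to every affine cone, also to that of the empty variety. Defining equations
  that all vanish there, thereby excluding nonzero constants, are obtained by multiplying given ones
  with the variables.
\<close>

lemma projective_variety_vanishing_at_0:
  assumes "projective_variety X"
  obtains S where "\<forall>f\<in>S. homogeneous_mpoly f" "\<forall>f\<in>S. eval_mpoly f 0 = 0" "X = zero_locus S"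
proof -
  obtain T where T: "\<forall>f\<in>T. homogeneous_mpoly f" "X = zero_locus T"
    using assms by (auto simp: projective_variety_def)
  define S where "S = {var_mpoly i * f |i f. f \<in> T}"
  have S: "\<forall>f\<in>S. homogeneous_mpoly f"
    using T(1) by (auto simp: S_def intro: homogeneous_mult homogeneous_var_mpoly)
  have "R \<in> zero_locus T \<longleftrightarrow> R \<in> zero_locus S" for R
  proof -
    obtain v where v: "v \<noteq> 0" "R = proj_point v" by (rule proj_point_cases)
    obtain i where "v $ i \<noteq> 0" using v(1) by (auto simp: vec_eq_iff)
    then have "(\<forall>f\<in>T. eval_mpoly f v = 0) \<longleftrightarrow> (\<forall>f\<in>S. eval_mpoly f v = 0)"
      by (force simp: S_def eval_mpoly_mult)
    then show ?thesis
      by (simp add: v(2) proj_point_in_zero_locus[OF T(1) v(1)] proj_point_in_zero_locus[OF S v(1)])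
  qed
  then have "X = zero_locus S" using T(2) by blast
  moreover have "\<forall>f\<in>S. eval_mpoly f 0 = 0" by (auto simp: S_def eval_mpoly_mult)
  ultimately show ?thesis using S that by blast
qed

lemma projective_variety_Int:
  assumes "projective_variety X" "projective_variety Y"
  shows "projective_variety (X \<inter> Y)"
proof -
  obtain S T where S: "\<forall>f\<in>S. homogeneous_mpoly f" "X = zero_locus S"
    and T: "\<forall>f\<in>T. homogeneous_mpoly f" "Y = zero_locus T"
    using assms by (auto simp: projective_variety_def)
  have ST: "\<forall>f\<in>S \<union> T. homogeneous_mpoly f" using S(1) T(1) by blast
  have "R \<in> X \<inter> Y \<longleftrightarrow> R \<in> zero_locus (S \<union> T)" for R
    by (cases R rule: proj_point_cases)
      (auto simp: S(2) T(2) proj_point_in_zero_locus[OF S(1)] proj_point_in_zero_locus[OF T(1)]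
        proj_point_in_zero_locus[OF ST])
  then show ?thesis using ST unfolding projective_variety_def by blast
qed

lemma projective_variety_Un:
  assumes "projective_variety X" "projective_variety Y"
  shows "projective_variety (X \<union> Y)"
proof -
  obtain S T where S: "\<forall>f\<in>S. homogeneous_mpoly f" "X = zero_locus S"
    and T: "\<forall>f\<in>T. homogeneous_mpoly f" "Y = zero_locus T"
    using assms by (auto simp: projective_variety_def)
  let ?U = "{f * g |f g. f \<in> S \<and> g \<in> T}"
  have ST: "\<forall>f\<in>?U. homogeneous_mpoly f" using S(1) T(1) homogeneous_mult by blast
  have "R \<in> X \<union> Y \<longleftrightarrow> R \<in> zero_locus ?U" for R
  proof -
    obtain v where v: "v \<noteq> 0" "R = proj_point v" by (rule proj_point_cases)
    have "(\<forall>f\<in>?U. eval_mpoly f v = 0)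
        \<longleftrightarrow> (\<forall>f\<in>S. eval_mpoly f v = 0) \<or> (\<forall>g\<in>T. eval_mpoly g v = 0)"
      by (force simp: eval_mpoly_mult)
    then show ?thesis
      using v by (simp add: S(2) T(2) proj_point_in_zero_locus[OF S(1)]
          proj_point_in_zero_locus[OF T(1)] proj_point_in_zero_locus[OF ST])
  qed
  then show ?thesis using ST unfolding projective_variety_def by blast
qed

lemma subset_if_vanishing_ideal_subset:
  assumes W: "projective_variety W"
    and sub: "vanishing_ideal (affine_cone W) \<subseteq> vanishing_ideal (affine_cone V)"
  shows "V \<subseteq> W"
proof
  fix R assume R: "R \<in> V"
  obtain S where S: "\<forall>f\<in>S. homogeneous_mpoly f" "\<forall>f\<in>S. eval_mpoly f 0 = 0" "W = zero_locus S"
    using projective_variety_vanishing_at_0[OF W] .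
  obtain v where v: "v \<noteq> 0" "R = proj_point v" by (rule proj_point_cases)
  have "f \<in> vanishing_ideal (affine_cone W)" if f: "f \<in> S" for f
    using f S by (auto simp: vanishing_ideal_def affine_cone_def proj_point_in_zero_locus)
  then have "\<forall>f\<in>S. eval_mpoly f v = 0"
    using sub R v by (force simp: vanishing_ideal_def affine_cone_iff)
  then show "R \<in> W" using v S by (simp add: proj_point_in_zero_locus)
qed

text \<open>
  If \<open>f * g\<close> vanishes on the cone, then on each line in the cone the restriction of \<open>f\<close> or that of
  \<open>g\<close> is the zero polynomial. Hence \<open>V\<close> is the union of the subvarieties where all components of
  \<open>f\<close>, respectively all components of \<open>g\<close>, vanish.
\<close>

lemma is_prime_ideal_vanishing_ideal:
  fixes V :: "('k::field_char_0, 'n::finite) proj set"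
  assumes V: "irreducible_variety V"
  shows "is_prime_ideal (vanishing_ideal (affine_cone V))"
proof -
  let ?I = "vanishing_ideal (affine_cone V)"
  have proj: "projective_variety V" and ne: "V \<noteq> {}"
    using V by (auto simp: irreducible_variety_def)
  have in_I: "f \<in> ?I" if "V \<subseteq> zero_locus (range (\<lambda>d. homogeneous_component d f))" for f
  proof -
    have van: "eval_mpoly f (t *s v) = 0" if "proj_point v \<in> V" "v \<noteq> 0" for v t
    proof (rule eval_eq_0_if_components)
      have "\<forall>g\<in>range (\<lambda>d. homogeneous_component d f). homogeneous_mpoly g"
        by (auto simp: homogeneous_homogeneous_component)
      from proj_point_in_zero_locus[OF this that(2)]
      show "eval_mpoly (homogeneous_component d f) v = 0" for d
        using \<open>V \<subseteq> _\<close> that(1) by blast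
    qed
    obtain R where "R \<in> V" using ne by blast
    then obtain v where v: "v \<noteq> 0" "proj_point v \<in> V" by (metis proj_point_cases)
    have "eval_mpoly f 0 = 0" using van[OF v(2,1), of 0] by simp
    then show ?thesis using van[of _ 1] by (auto simp: vanishing_ideal_def affine_cone_def)
  qed
  show ?thesis
    unfolding is_prime_ideal_def
  proof (intro conjI allI impI is_ideal_vanishing_ideal)
    show "1 \<notin> ?I"
    proof
      assume "1 \<in> ?I"
      then have "eval_mpoly 1 (0 :: 'k ^ 'n) = 0"
        using zero_in_affine_cone unfolding vanishing_ideal_def by blast
      then show False by simp
    qed
  next
    fix f g assume fg: "f * g \<in> ?I"
    let ?Z = "\<lambda>f. zero_locus (range (\<lambda>d. homogeneous_component d f))"
    have hom: "\<forall>h\<in>range (\<lambda>d. homogeneous_component d f). homogeneous_mpoly h" for f :: "('k, 'n) mpoly"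
      by (auto simp: homogeneous_homogeneous_component)
    have "V \<subseteq> ?Z f \<union> ?Z g"
    proof
      fix R assume R: "R \<in> V"
      obtain v where v: "v \<noteq> 0" "R = proj_point v" by (rule proj_point_cases)
      have "poly (line_poly f v * line_poly g v) t = 0" for t
      proof -
        have "t *s v \<in> affine_cone V"
          using R v by (intro affine_cone_scale) (simp add: affine_cone_iff)
        then show ?thesis
          using fg by (simp add: poly_line_poly vanishing_ideal_def flip: eval_mpoly_mult)
      qed
      then have "line_poly f v = 0 \<or> line_poly g v = 0"
        using poly_all_0_iff_0[of "line_poly f v * line_poly g v"] by auto
      then show "R \<in> ?Z f \<union> ?Z g"
        by (auto simp: v proj_point_in_zero_locus[OF hom v(1)] simp flip: coeff_line_poly)
    qed
    then have "V = (V \<inter> ?Z f) \<union> (V \<inter> ?Z g)" by blast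
    moreover have "projective_variety (V \<inter> ?Z h)" for h
      using hom[of h] by (intro projective_variety_Int[OF proj]) (unfold projective_variety_def, blast)
    ultimately have "V = V \<inter> ?Z f \<or> V = V \<inter> ?Z g"
      using V unfolding irreducible_variety_def by blast
    then show "f \<in> ?I \<or> g \<in> ?I" using in_I by blast
  qed
qed

lemma irreducible_eq_if_proj_dim_eq:
  fixes V :: "('k::field_char_0, 'n::finite) proj set"
  assumes V: "irreducible_variety V" and W: "projective_variety W" and sub: "W \<subseteq> V"
    and dim: "proj_dim V = ereal r" "proj_dim W = ereal r"
  shows "W = V"
proof -
  let ?I = "\<lambda>V. vanishing_ideal (affine_cone V)"
  have aff: "affine_dim (affine_cone X) = ereal (r + 1)" if "proj_dim X = ereal r"
    for X :: "('k, 'n) proj set"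
    using that unfolding proj_dim_def by (cases "affine_dim (affine_cone X)") (auto simp: one_ereal_def)
  have "?I V \<subseteq> ?I W" using affine_cone_mono[OF sub] by (auto simp: vanishing_ideal_def)
  moreover have "\<not> ?I V \<subset> ?I W"
    using krull_dim_Quot_strict[OF is_prime_ideal_vanishing_ideal[OF V] is_ideal_vanishing_ideal]
      aff[OF dim(1)] aff[OF dim(2)] unfolding affine_dim_def by blast
  ultimately show ?thesis using subset_if_vanishing_ideal_subset[OF W, of V] sub by blast
qed

section \<open>Complexification\<close>

lemma lookup_poly_mapping_map:
  assumes "h 0 = 0"
  shows "Poly_Mapping.lookup (Poly_Mapping.map h f) m = h (Poly_Mapping.lookup f m)"
  using assms by transfer (auto simp: when_def)

lemma poly_mapping_map_add:
  assumes "h 0 = 0" "\<And>a b. h (a + b) = h a + h b"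
  shows "Poly_Mapping.map h (f + g) = Poly_Mapping.map h f + Poly_Mapping.map h g"
  by (rule poly_mapping_eqI) (simp add: lookup_add lookup_poly_mapping_map assms)

lemma poly_mapping_map_mult:
  fixes h :: "'k::comm_ring_1 \<Rightarrow> 'l::comm_ring_1" and f g :: "('k, 'n::finite) mpoly"
  assumes h0: "h 0 = 0" and ha: "\<And>a b. h (a + b) = h a + h b" and hm: "\<And>a b. h (a * b) = h a * h b"
  shows "Poly_Mapping.map h (f * g) = Poly_Mapping.map h f * Poly_Mapping.map h g"
proof (induction f rule: poly_mapping_single_induct)
  case (single m c)
  show ?case
    by (induction g rule: poly_mapping_single_induct)
      (simp_all add: mult_single h0 hm poly_mapping_map_add[of h, OF h0 ha] distrib_left)
qed (simp add: poly_mapping_map_add[of h, OF h0 ha] distrib_right)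

lemma homogeneous_map:
  assumes "h 0 = 0" "homogeneous_mpoly f"
  shows "homogeneous_mpoly (Poly_Mapping.map h f)"
proof -
  have "Poly_Mapping.keys (Poly_Mapping.map h f) \<subseteq> Poly_Mapping.keys f"
    using assms(1) by (auto simp: in_keys_iff lookup_poly_mapping_map)
  then show ?thesis using assms(2) unfolding homogeneous_mpoly_def by blast
qed

lemma prod_complex_vec:
  "(\<Prod>i\<in>UNIV. (complex_vec v $ i) ^ k i) = complex_of_real (\<Prod>i\<in>UNIV. (v $ i) ^ k i)"
  by (simp add: complex_vec_def)

lemma eval_map_of_real:
  "eval_mpoly (Poly_Mapping.map complex_of_real f) (complex_vec v) = complex_of_real (eval_mpoly f v)"
  by (induction f rule: poly_mapping_single_induct)
    (simp_all add: eval_mpoly_single prod_complex_vec eval_mpoly_add poly_mapping_map_add[of complex_of_real])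

lemma eval_map_Re: "eval_mpoly (Poly_Mapping.map Re f) v = Re (eval_mpoly f (complex_vec v))"
  by (induction f rule: poly_mapping_single_induct)
    (simp_all add: eval_mpoly_single prod_complex_vec eval_mpoly_add poly_mapping_map_add[of Re]
      del: of_real_prod of_real_power)

lemma eval_map_Im: "eval_mpoly (Poly_Mapping.map Im f) v = Im (eval_mpoly f (complex_vec v))"
  by (induction f rule: poly_mapping_single_induct)
    (simp_all add: eval_mpoly_single prod_complex_vec eval_mpoly_add poly_mapping_map_add[of Im]
      del: of_real_prod of_real_power)

lemma fixed_by_cnj_in_range:
  assumes "Poly_Mapping.map cnj g = g"
  shows "g \<in> range (Poly_Mapping.map complex_of_real)"
proof
  show "g = Poly_Mapping.map complex_of_real (Poly_Mapping.map Re g)"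
  proof (rule poly_mapping_eqI)
    fix m
    have "cnj (Poly_Mapping.lookup g m) = Poly_Mapping.lookup g m"
      using assms lookup_poly_mapping_map[of cnj g m] by simp
    then show "Poly_Mapping.lookup g m
        = Poly_Mapping.lookup (Poly_Mapping.map complex_of_real (Poly_Mapping.map Re g)) m"
      by (simp add: lookup_poly_mapping_map complex_eq_iff)
  qed
qed simp

interpretation complexification: involutive_extension
  "Poly_Mapping.map complex_of_real :: (real, 'n::finite) mpoly \<Rightarrow> (complex, 'n) mpoly"
  "Poly_Mapping.map cnj :: (complex, 'n) mpoly \<Rightarrow> (complex, 'n) mpoly"
proof
  fix a b :: "(real, 'n) mpoly" and x y :: "(complex, 'n) mpoly"
  have invol: "Poly_Mapping.map cnj (Poly_Mapping.map cnj x) = x" for x :: "(complex, 'n) mpoly"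
    by (rule poly_mapping_eqI) (simp add: lookup_poly_mapping_map)
  show "Poly_Mapping.map complex_of_real (a + b)
      = Poly_Mapping.map complex_of_real a + Poly_Mapping.map complex_of_real b"
    by (simp add: poly_mapping_map_add)
  show "Poly_Mapping.map complex_of_real (a * b)
      = Poly_Mapping.map complex_of_real a * Poly_Mapping.map complex_of_real b"
    by (simp add: poly_mapping_map_mult)
  show "Poly_Mapping.map complex_of_real (1 :: (real, 'n) mpoly) = 1"
    by (simp flip: single_one)
  show add: "Poly_Mapping.map cnj (x + y) = Poly_Mapping.map cnj x + Poly_Mapping.map cnj y"
    for x y :: "(complex, 'n) mpoly"
    by (simp add: poly_mapping_map_add)
  show mult: "Poly_Mapping.map cnj (x * y) = Poly_Mapping.map cnj x * Poly_Mapping.map cnj y"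
    for x y :: "(complex, 'n) mpoly"
    by (simp add: poly_mapping_map_mult)
  show "Poly_Mapping.map cnj (Poly_Mapping.map cnj x) = x" by (rule invol)
  show "Poly_Mapping.map cnj (Poly_Mapping.map complex_of_real a) = Poly_Mapping.map complex_of_real a"
    by (rule poly_mapping_eqI) (simp add: lookup_poly_mapping_map)
  show "x + Poly_Mapping.map cnj x \<in> range (Poly_Mapping.map complex_of_real)"
    by (rule fixed_by_cnj_in_range) (simp add: add invol add.commute)
  show "x * Poly_Mapping.map cnj x \<in> range (Poly_Mapping.map complex_of_real)"
    by (rule fixed_by_cnj_in_range) (simp add: mult invol mult.commute)
qed

section \<open>The complex closure of a real projective variety\<close>

text \<open>
  The complex homogeneous polynomials that vanish on the real cone of \<open>X\<close>; these generate
  \<open>complex_ideal X\<close>. The origin lies in the cone, so nonzero constants are excluded even if \<open>X\<close> is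
  empty.
\<close>

definition real_forms :: "(real, 'n::finite) proj set \<Rightarrow> (complex, 'n) mpoly set"
  where "real_forms X =
    {f. homogeneous_mpoly f \<and> (\<forall>v\<in>affine_cone X. eval_mpoly f (complex_vec v) = 0)}"

lemma homogeneous_real_forms: "\<forall>f\<in>real_forms X. homogeneous_mpoly f"
  by (simp add: real_forms_def)

lemma zero_locus_genideal: "zero_locus (Idl\<^bsub>mpoly_ring\<^esub> S) = zero_locus S"
proof -
  interpret R: cring "mpoly_ring :: ('a, 'b) mpoly ring" by (rule cring_type_ring)
  have "(\<forall>f\<in>Idl\<^bsub>mpoly_ring\<^esub> S. eval_mpoly f v = 0) \<longleftrightarrow> (\<forall>f\<in>S. eval_mpoly f v = 0)" for v :: "'a ^ 'b"
  proof
    assume "\<forall>f\<in>S. eval_mpoly f v = 0"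
    then have "S \<subseteq> vanishing_ideal {v}" by (auto simp: vanishing_ideal_def)
    moreover have "ideal (vanishing_ideal {v}) mpoly_ring"
      using is_ideal_vanishing_ideal by (simp add: ideal_type_ring_iff)
    ultimately have "Idl\<^bsub>mpoly_ring\<^esub> S \<subseteq> vanishing_ideal {v}" by (intro R.genideal_minimal)
    then show "\<forall>f\<in>Idl\<^bsub>mpoly_ring\<^esub> S. eval_mpoly f v = 0" by (auto simp: vanishing_ideal_def)
  qed (use R.genideal_self[of S] in auto)
  then show ?thesis by (simp add: zero_locus_def)
qed

lemma ZI_eq: "ZI X = zero_locus (real_forms X)"
  by (simp add: ZI_def complex_ideal_def zero_locus_genideal real_forms_def)

lemma projective_variety_ZI: "projective_variety (ZI X)"
  using homogeneous_real_forms unfolding ZI_eq projective_variety_def by blast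

lemma proj_point_in_ZI:
  "v \<noteq> 0 \<Longrightarrow> proj_point v \<in> ZI X \<longleftrightarrow> (\<forall>f\<in>real_forms X. eval_mpoly f v = 0)"
  by (simp add: ZI_eq proj_point_in_zero_locus[OF homogeneous_real_forms])

lemma subset_ZI: "X \<subseteq> complex_point -` ZI X"
proof
  fix R assume "R \<in> X"
  then show "R \<in> complex_point -` ZI X"
    by (cases R rule: proj_point_cases)
      (auto simp: complex_point_proj_point proj_point_in_ZI real_forms_def affine_cone_iff)
qed

lemma ZI_minimal:
  assumes V: "projective_variety V" and XV: "X \<subseteq> complex_point -` V"
  shows "ZI X \<subseteq> V"
proof
  fix R assume R: "R \<in> ZI X"
  obtain S where S: "\<forall>f\<in>S. homogeneous_mpoly f" "\<forall>f\<in>S. eval_mpoly f 0 = 0" "V = zero_locus S"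
    using projective_variety_vanishing_at_0[OF V] .
  obtain w where w: "w \<noteq> 0" "R = proj_point w" by (rule proj_point_cases)
  have "eval_mpoly f (complex_vec v) = 0" if f: "f \<in> S" and v: "v \<in> affine_cone X" for f v
  proof (cases "v = 0")
    case True
    then show ?thesis using f S(2) by (simp add: complex_vec_def zero_vec_def)
  next
    case False
    then have "proj_point (complex_vec v) \<in> V"
      using v XV complex_point_proj_point[OF False] by (auto simp: affine_cone_iff)
    then show ?thesis using f False S(3) by (simp add: proj_point_in_zero_locus[OF S(1)])
  qed
  then have "S \<subseteq> real_forms X" using S(1) by (auto simp: real_forms_def)
  then show "R \<in> V" using R w S(3) by (auto simp: proj_point_in_ZI proj_point_in_zero_locus[OF S(1)])
qed

lemma ZI_mono: "X \<subseteq> Y \<Longrightarrow> ZI X \<subseteq> ZI Y"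
  using subset_ZI[of Y] by (intro ZI_minimal projective_variety_ZI) auto

lemma ZI_Un: "ZI (X \<union> Y) = ZI X \<union> ZI Y"
proof
  show "ZI (X \<union> Y) \<subseteq> ZI X \<union> ZI Y"
    using subset_ZI[of X] subset_ZI[of Y]
    by (intro ZI_minimal projective_variety_Un projective_variety_ZI) auto
qed (simp add: ZI_mono)

lemma ZI_empty: "ZI {} = {}"
proof -
  have "projective_variety ({} :: (complex, 'a) proj set)"
    by (auto simp: projective_variety_def zero_locus_def homogeneous_mpoly_def intro!: exI[of _ "{1}"])
  from ZI_minimal[OF this, of "{}"] show ?thesis by simp
qed

lemma real_points_ZI:
  assumes Y: "projective_variety Y"
  shows "complex_point -` ZI Y = Y"
proof
  show "complex_point -` ZI Y \<subseteq> Y"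
  proof
    fix R assume R: "R \<in> complex_point -` ZI Y"
    obtain S where S: "\<forall>f\<in>S. homogeneous_mpoly f" "\<forall>f\<in>S. eval_mpoly f 0 = 0" "Y = zero_locus S"
      using projective_variety_vanishing_at_0[OF Y] .
    obtain v where v: "v \<noteq> 0" "R = proj_point v" by (rule proj_point_cases)
    have "eval_mpoly f v = 0" if f: "f \<in> S" for f
    proof -
      have "\<forall>u\<in>affine_cone Y. eval_mpoly f u = 0"
        using f S by (auto simp: affine_cone_def proj_point_in_zero_locus)
      then have "Poly_Mapping.map complex_of_real f \<in> real_forms Y"
        using f S(1) by (simp add: real_forms_def homogeneous_map eval_map_of_real)
      then show ?thesis
        using R v by (auto simp: complex_point_proj_point proj_point_in_ZI eval_map_of_real)
    qed
    then show "R \<in> Y" using v S by (simp add: proj_point_in_zero_locus)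
  qed
qed (rule subset_ZI)

lemma projective_variety_real_inter:
  assumes V: "projective_variety V" and X: "projective_variety X"
  shows "projective_variety (V \<inter>\<^sub>R X)"
proof -
  obtain S where S: "\<forall>f\<in>S. homogeneous_mpoly f" "V = zero_locus S"
    using V by (auto simp: projective_variety_def)
  let ?T = "Poly_Mapping.map Re ` S \<union> Poly_Mapping.map Im ` S"
  have T: "\<forall>f\<in>?T. homogeneous_mpoly f" using S(1) by (auto intro: homogeneous_map)
  have "R \<in> complex_point -` V \<longleftrightarrow> R \<in> zero_locus ?T" for R
  proof (cases R rule: proj_point_cases)
    case (1 v)
    then show ?thesis
      by (auto simp: S(2) complex_point_proj_point proj_point_in_zero_locus[OF S(1)]
          proj_point_in_zero_locus[OF T] eval_map_Re eval_map_Im complex_eq_iff ball_Un)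
  qed
  then have "complex_point -` V = zero_locus ?T" by blast
  then have "projective_variety (complex_point -` V)"
    using T unfolding projective_variety_def by blast
  then show ?thesis using X unfolding real_inter_def by (rule projective_variety_Int)
qed

text \<open>
  A polynomial vanishing on the real cone of \<open>X\<close> has components that vanish there as well, because a
  polynomial in one complex variable with all real numbers as roots is zero. The components are thus
  among the equations of \<open>ZI X\<close>.
\<close>

lemma vanishing_ideal_cone_ZI:
  "vanishing_ideal (affine_cone (ZI X)) = vanishing_ideal (complex_vec ` affine_cone X)"
proof
  have "complex_vec ` affine_cone X \<subseteq> affine_cone (ZI X)"
  proof (rule image_subsetI)
    fix v assume v: "v \<in> affine_cone X"
    show "complex_vec v \<in> affine_cone (ZI X)"
    proof (cases "v = 0")
      case False
      then show ?thesis
        using v subset_ZI[of X] complex_point_proj_point[OF False] by (auto simp: affine_cone_iff)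
    qed (simp add: affine_cone_def)
  qed
  then show "vanishing_ideal (affine_cone (ZI X)) \<subseteq> vanishing_ideal (complex_vec ` affine_cone X)"
    by (auto simp: vanishing_ideal_def)
next
  show "vanishing_ideal (complex_vec ` affine_cone X) \<subseteq> vanishing_ideal (affine_cone (ZI X))"
  proof
    fix g assume "g \<in> vanishing_ideal (complex_vec ` affine_cone X)"
    then have g: "eval_mpoly g (complex_vec v) = 0" if "v \<in> affine_cone X" for v
      using that by (auto simp: vanishing_ideal_def)
    have comp: "homogeneous_component d g \<in> real_forms X" for d
    proof -
      have "eval_mpoly (homogeneous_component d g) (complex_vec v) = 0" if v: "v \<in> affine_cone X" for v
      proof -
        have "poly (line_poly g (complex_vec v)) (complex_of_real t) = 0" for t
          using g[OF affine_cone_scale[OF v, of t]] by (simp add: poly_line_poly complex_vec_scale)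
        then have "range complex_of_real \<subseteq> {z. poly (line_poly g (complex_vec v)) z = 0}" by blast
        moreover have "infinite (range complex_of_real)"
          using finite_imageD[of complex_of_real UNIV] infinite_UNIV_char_0 by (auto simp: inj_on_def)
        ultimately have "line_poly g (complex_vec v) = 0"
          using poly_roots_finite finite_subset by blast
        then show ?thesis by (simp flip: coeff_line_poly)
      qed
      then show ?thesis by (simp add: real_forms_def homogeneous_homogeneous_component)
    qed
    have "eval_mpoly g w = 0" if w: "w \<in> affine_cone (ZI X)" for w
    proof (cases "w = 0")
      case True
      have "w = complex_vec 0" using True by (simp add: complex_vec_def zero_vec_def)
      then show ?thesis using g[of 0] by simp
    next
      case False
      then have "eval_mpoly (homogeneous_component d g) w = 0" for d
        using w comp by (auto simp: affine_cone_iff proj_point_in_ZI)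
      from eval_eq_0_if_components[OF this, of 1] show ?thesis by simp
    qed
    then show "g \<in> vanishing_ideal (affine_cone (ZI X))" by (simp add: vanishing_ideal_def)
  qed
qed

lemma proj_dim_ZI: "proj_dim (ZI X) = proj_dim X"
proof -
  have "complexification.contract (vanishing_ideal (affine_cone (ZI X)))
      = vanishing_ideal (affine_cone X)"
    unfolding vanishing_ideal_cone_ZI by (auto simp: vanishing_ideal_def eval_map_of_real)
  then show ?thesis
    using complexification.krull_dim_contract[OF is_ideal_vanishing_ideal, of "affine_cone (ZI X)"]
    by (simp add: proj_dim_def affine_dim_def)
qed

lemma irreducible_variety_ZI:
  assumes Y: "irreducible_variety Y"
  shows "irreducible_variety (ZI Y)"
  unfolding irreducible_variety_def
proof (intro conjI allI impI projective_variety_ZI)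
  show "ZI Y \<noteq> {}" using Y subset_ZI[of Y] by (auto simp: irreducible_variety_def)
next
  fix A B :: "(complex, 'a) proj set"
  assume A: "projective_variety A" and B: "projective_variety B" and AB: "ZI Y = A \<union> B"
  have YV: "projective_variety Y" using Y by (simp add: irreducible_variety_def)
  have "Y = (A \<inter>\<^sub>R Y) \<union> (B \<inter>\<^sub>R Y)" using subset_ZI[of Y] AB by (auto simp: real_inter_def)
  then have "Y = A \<inter>\<^sub>R Y \<or> Y = B \<inter>\<^sub>R Y"
    using Y projective_variety_real_inter[OF A YV] projective_variety_real_inter[OF B YV]
    unfolding irreducible_variety_def by blast
  then have "ZI Y \<subseteq> A \<or> ZI Y \<subseteq> B"
    using ZI_minimal[OF A, of Y] ZI_minimal[OF B, of Y] by (auto simp: real_inter_def)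
  then show "ZI Y = A \<or> ZI Y = B" using AB by blast
qed

lemma irreducible_variety_if_ZI:
  assumes Y: "projective_variety Y" and irr: "irreducible_variety (ZI Y)"
  shows "irreducible_variety Y"
  unfolding irreducible_variety_def
proof (intro conjI allI impI Y)
  show "Y \<noteq> {}" using irr ZI_empty by (auto simp: irreducible_variety_def)
next
  fix A B assume A: "projective_variety A" and B: "projective_variety B" and AB: "Y = A \<union> B"
  have "ZI Y = ZI A \<or> ZI Y = ZI B"
    using irr ZI_Un[of A B] projective_variety_ZI unfolding irreducible_variety_def AB by blast
  then show "Y = A \<or> Y = B" using real_points_ZI A B Y by metis
qed

theorem proposition2p3:
  fixes X :: "(real, 'n::finite) proj set"
  assumes "projective_variety X"
  shows
    "(\<forall>Y. projective_variety Y \<and> Y \<subseteq> X \<longrightarrow> ZI Y \<inter>\<^sub>R X = Y)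
     \<and> (\<forall>Y (p::nat). irreducible_variety Y \<and> Y \<subseteq> X \<and> proj_dim Y = ereal (real p) \<longrightarrow>
          irreducible_variety (ZI Y) \<and> proj_dim (ZI Y) = ereal (real p) \<and> ZI Y \<subseteq> ZI X)
     \<and> (\<forall>V (p::nat). irreducible_variety V \<and> V \<subseteq> ZI X \<and> proj_dim V = ereal (real p)
            \<and> proj_dim (V \<inter>\<^sub>R X) = ereal (real p) \<longrightarrow>
          irreducible_variety (V \<inter>\<^sub>R X) \<and> V \<inter>\<^sub>R X \<subseteq> X \<and> ZI (V \<inter>\<^sub>R X) = V)"
proof (intro conjI allI impI)
  fix Y assume "projective_variety Y \<and> Y \<subseteq> X"
  then show "ZI Y \<inter>\<^sub>R X = Y" using real_points_ZI[of Y] by (auto simp: real_inter_def)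
next
  fix Y and p :: nat
  assume Y: "irreducible_variety Y \<and> Y \<subseteq> X \<and> proj_dim Y = ereal (real p)"
  then show "irreducible_variety (ZI Y)" by (simp add: irreducible_variety_ZI)
  show "proj_dim (ZI Y) = ereal (real p)" using Y by (simp add: proj_dim_ZI)
  show "ZI Y \<subseteq> ZI X" using Y by (simp add: ZI_mono)
next
  fix V and p :: nat
  assume V: "irreducible_variety V \<and> V \<subseteq> ZI X \<and> proj_dim V = ereal (real p)
    \<and> proj_dim (V \<inter>\<^sub>R X) = ereal (real p)"
  then have PV: "projective_variety V" by (simp add: irreducible_variety_def)
  have "ZI (V \<inter>\<^sub>R X) \<subseteq> V" by (rule ZI_minimal[OF PV]) (simp add: real_inter_def)
  then show ZI: "ZI (V \<inter>\<^sub>R X) = V"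
    using V by (intro irreducible_eq_if_proj_dim_eq[of V _ p] projective_variety_ZI)
      (simp_all add: proj_dim_ZI)
  show "irreducible_variety (V \<inter>\<^sub>R X)"
    using V by (intro irreducible_variety_if_ZI projective_variety_real_inter PV assms) (simp add: ZI)
  show "V \<inter>\<^sub>R X \<subseteq> X" by (simp add: real_inter_def)
qed

end
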